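(* Let $n\geq 3$. Then $\langle\beta_n,\gamma_n\rangle\subseteq Out(UVB_n)$, where $\langle\beta_n,\gamma_n\rangle\cong\mathbb{Z}_2\times\mathbb{Z}_2$; that is, the classes of the automorphisms $\beta_n$ and $\gamma_n$ in $Out(UVB_n)$ generate a subgroup isomorphic to $\mathbb{Z}_2\times\mathbb{Z}_2$.
   Context: The unrestricted virtual braid group $UVB_n$ is the group with generators $\sigma_1,\dots,\sigma_{n-1},\rho_1,\dots,\rho_{n-1}$ and relations: $\sigma_i\sigma_{i+1}\sigma_i=\sigma_{i+1}\sigma_i\sigma_{i+1}$ ($1\le i\le n-2$); $\sigma_i\sigma_j=\sigma_j\sigma_i$ ($|i-j|>1$); $\rho_i\rho_{i+1}\rho_i=\rho_{i+1}\rho_i\rho_{i+1}$ ($1\le i\le n-2$); $\rho_i\rho_j=\rho_j\rho_i$ ($|i-j|>1$); $\rho_i^2=1$ ($1\le i\le n-1$); $\sigma_i\rho_j=\rho_j\sigma_i$ ($|i-j|>1$); $\sigma_i\rho_{i+1}\rho_i=\rho_{i+1}\rho_i\sigma_{i+1}$ ($1\le i\le n-2$); $\rho_i\sigma_{i+1}\sigma_i=\sigma_{i+1}\sigma_i\rho_{i+1}$ ($1\le i\le n-2$); $\rho_{i+1}\sigma_i\sigma_{i+1}=\sigma_i\sigma_{i+1}\rho_i$ ($1\le i\le n-2$). The maps $\beta_n,\gamma_n:UVB_n\to UVB_n$ are the automorphisms determined, for $1\le i\le n-1$, by $\beta_n:\sigma_i\mapsto\sigma_i^{-1},\ \rho_i\mapsto\rho_i$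 and $\gamma_n:\sigma_i\mapsto\rho_i\sigma_i\rho_i,\ \rho_i\mapsto\rho_i$. $Out(UVB_n)=Aut(UVB_n)/Inn(UVB_n)$. *)

theory Defs
  imports "HOL-Algebra.Algebra"
begin

section \<open>Groups given by generators and relations\<close>

text \<open>A word is a list of letters; \<open>(x, True)\<close> stands for the generator \<open>x\<close> and
  \<open>(x, False)\<close> for its formal inverse.  A pair \<open>(u, v)\<close> of words in \<open>R\<close> stands for the
  relation \<open>u = v\<close>.\<close>

type_synonym 'g word = "('g \<times> bool) list"

definition words :: "'g set \<Rightarrow> 'g word set" where
  "words S = lists (S \<times> UNIV)"

inductive pres_eq :: "'g set \<Rightarrow> ('g word \<times> 'g word) set \<Rightarrow> 'g word \<Rightarrow> 'g word \<Rightarrow> bool"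
  for S R where
  refl: "w \<in> words S \<Longrightarrow> pres_eq S R w w"
| sym: "pres_eq S R u v \<Longrightarrow> pres_eq S R v u"
| trans: "pres_eq S R u v \<Longrightarrow> pres_eq S R v w \<Longrightarrow> pres_eq S R u w"
| append: "pres_eq S R u v \<Longrightarrow> pres_eq S R u' v' \<Longrightarrow> pres_eq S R (u @ u') (v @ v')"
| cancel: "x \<in> S \<Longrightarrow> pres_eq S R [(x, b), (x, \<not> b)] []"
| rel: "(u, v) \<in> R \<Longrightarrow> u \<in> words S \<Longrightarrow> v \<in> words S \<Longrightarrow> pres_eq S R u v"

definition pres_class :: "'g set \<Rightarrow> ('g word \<times> 'g word) set \<Rightarrow> 'g word \<Rightarrow> 'g word set" where
  "pres_class S R w = {v. pres_eq S R w v}"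

definition presented_group :: "'g set \<Rightarrow> ('g word \<times> 'g word) set \<Rightarrow> 'g word set monoid" where
  "presented_group S R =
    \<lparr>carrier = pres_class S R ` words S,
     monoid.mult = (\<lambda>A B. {w. \<exists>u\<in>A. \<exists>v\<in>B. pres_eq S R (u @ v) w}),
     one = pres_class S R []\<rparr>"

lemma words_append [simp]: "u @ v \<in> words S \<longleftrightarrow> u \<in> words S \<and> v \<in> words S"
  by (simp add: words_def)

lemma words_Nil [simp]: "[] \<in> words S"
  by (simp add: words_def)

lemma words_Cons [simp]: "(x, b) # w \<in> words S \<longleftrightarrow> x \<in> S \<and> w \<in> words S"
  by (auto simp: words_def)

lemma pres_eq_words: "pres_eq S R u v \<Longrightarrow> u \<in> words S \<and> v \<in> words S"
  by (induction rule: pres_eq.induct) auto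

lemma pres_class_eq_iff:
  "u \<in> words S \<Longrightarrow> pres_class S R u = pres_class S R v \<longleftrightarrow> pres_eq S R u v"
  unfolding pres_class_def by (auto intro: pres_eq.intros dest: pres_eq.sym pres_eq.trans)

lemma presented_mult:
  assumes "u \<in> words S" "v \<in> words S"
  shows "pres_class S R u \<otimes>\<^bsub>presented_group S R\<^esub> pres_class S R v = pres_class S R (u @ v)"
proof -
  have "pres_eq S R (u @ v) w"
    if "pres_eq S R u u'" "pres_eq S R v v'" "pres_eq S R (u' @ v') w" for u' v' w
    using that by (meson pres_eq.append pres_eq.trans)
  moreover have "pres_eq S R u u" "pres_eq S R v v"
    using assms by (auto intro: pres_eq.refl)
  ultimately show ?thesis
    unfolding presented_group_def pres_class_def by auto
qed

lemma presented_one: "\<one>\<^bsub>presented_group S R\<^esub> = pres_class S R []"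
  by (simp add: presented_group_def)

lemma presented_carrier: "carrier (presented_group S R) = pres_class S R ` words S"
  by (simp add: presented_group_def)

lemma pres_eq_inverse:
  "w \<in> words S \<Longrightarrow> pres_eq S R (rev (map (\<lambda>(x, b). (x, \<not> b)) w) @ w) []"
proof (induction w)
  case Nil
  then show ?case by (simp add: pres_eq.refl)
next
  case (Cons a w)
  obtain x b where a: "a = (x, b)" by fastforce
  let ?w = "rev (map (\<lambda>(x, b). (x, \<not> b)) w)"
  have x: "x \<in> S" and w: "w \<in> words S" using Cons.prems a by auto
  have IH: "pres_eq S R (?w @ w) []" using Cons.IH w by simp
  then have w': "pres_eq S R ?w ?w" "pres_eq S R w w"
    using pres_eq_words[OF IH] by (auto intro: pres_eq.refl)
  have "pres_eq S R ([(x, \<not> b), (x, b)] @ w) ([] @ w)"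
    using pres_eq.append[OF pres_eq.cancel[OF x, of R "\<not> b"] w'(2)] by simp
  from pres_eq.append[OF w'(1) this]
  show ?case using IH a by (auto intro: pres_eq.trans)
qed

lemma inverse_words: "w \<in> words S \<Longrightarrow> rev (map (\<lambda>(x, b). (x, \<not> b)) w) \<in> words S"
  using pres_eq_words[OF pres_eq_inverse[of w S "{}"]] by auto

lemma group_presented_group: "group (presented_group S R)"
proof (rule groupI)
  fix x assume "x \<in> carrier (presented_group S R)"
  then obtain w where w: "w \<in> words S" "x = pres_class S R w"
    by (auto simp: presented_carrier)
  have "pres_class S R (rev (map (\<lambda>(x, b). (x, \<not> b)) w)) \<otimes>\<^bsub>presented_group S R\<^esub> x
     = \<one>\<^bsub>presented_group S R\<^esub>"
    using w inverse_words[OF w(1)] pres_eq_inverse[OF w(1)]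
    by (simp add: presented_mult presented_one pres_class_eq_iff)
  then show "\<exists>y\<in>carrier (presented_group S R).
      y \<otimes>\<^bsub>presented_group S R\<^esub> x = \<one>\<^bsub>presented_group S R\<^esub>"
    using inverse_words[OF w(1)] by (auto simp: presented_carrier)
qed (auto simp: presented_carrier presented_mult presented_one intro!: imageI)

fun word_eval :: "('h, 'c) monoid_scheme \<Rightarrow> ('g \<Rightarrow> 'h) \<Rightarrow> 'g word \<Rightarrow> 'h" where
  "word_eval H f [] = \<one>\<^bsub>H\<^esub>"
| "word_eval H f ((x, b) # w) = (if b then f x else inv\<^bsub>H\<^esub> f x) \<otimes>\<^bsub>H\<^esub> word_eval H f w"

context group
begin

lemma word_eval_closed:
  "f \<in> S \<rightarrow> carrier G \<Longrightarrow> w \<in> words S \<Longrightarrow> word_eval G f w \<in> carrier G"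
  by (induction w) (auto simp: Pi_iff)

lemma word_eval_append:
  "f \<in> S \<rightarrow> carrier G \<Longrightarrow> u \<in> words S \<Longrightarrow> v \<in> words S \<Longrightarrow>
    word_eval G f (u @ v) = word_eval G f u \<otimes> word_eval G f v"
  by (induction u) (auto simp: Pi_iff m_assoc word_eval_closed)

lemma word_eval_cong:
  assumes f: "f \<in> S \<rightarrow> carrier G"
    and R: "\<And>u v. (u, v) \<in> R \<Longrightarrow> u \<in> words S \<Longrightarrow> v \<in> words S \<Longrightarrow> word_eval G f u = word_eval G f v"
  shows "pres_eq S R u v \<Longrightarrow> word_eval G f u = word_eval G f v"
proof (induction rule: pres_eq.induct)
  case (append u v u' v')
  then show ?case
    using word_eval_append[OF f] by (metis pres_eq_words)
next
  case (cancel x b)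
  then have "f x \<in> carrier G" using f by auto
  then show ?case by (cases b) auto
qed (use R in auto)

lemma presented_lift:
  assumes f: "f \<in> S \<rightarrow> carrier G"
    and R: "\<And>u v. (u, v) \<in> R \<Longrightarrow> u \<in> words S \<Longrightarrow> v \<in> words S \<Longrightarrow> word_eval G f u = word_eval G f v"
  obtains h where "h \<in> hom (presented_group S R) G"
    "\<And>x. x \<in> S \<Longrightarrow> h (pres_class S R [(x, True)]) = f x"
proof
  define h where "h A = word_eval G f (SOME w. w \<in> A)" for A
  have h: "h (pres_class S R w) = word_eval G f w" if w: "w \<in> words S" for w
  proof -
    have "w \<in> pres_class S R w" using w by (auto simp: pres_class_def intro: pres_eq.refl)
    then have "(SOME v. v \<in> pres_class S R w) \<in> pres_class S R w" by (rule someI)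
    then have "pres_eq S R w (SOME v. v \<in> pres_class S R w)" by (simp add: pres_class_def)
    from word_eval_cong[OF f R this] show ?thesis by (simp add: h_def)
  qed
  show "h \<in> hom (presented_group S R) G"
    by (rule homI)
      (auto simp: presented_carrier presented_mult h word_eval_append[OF f] word_eval_closed[OF f])
  show "\<And>x. x \<in> S \<Longrightarrow> h (pres_class S R [(x, True)]) = f x"
    using f by (auto simp: h Pi_iff)
qed

lemma presented_hom_eq:
  assumes h: "h \<in> hom (presented_group S R) G" and k: "k \<in> hom (presented_group S R) G"
    and hk: "\<And>x. x \<in> S \<Longrightarrow> h (pres_class S R [(x, True)]) = k (pres_class S R [(x, True)])"
    and x: "x \<in> carrier (presented_group S R)"
  shows "h x = k x"
proof -
  let ?P = "presented_group S R"
  interpret P: group ?P by (rule group_presented_group)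
  interpret h: group_hom ?P G h by unfold_locales (rule h)
  interpret k: group_hom ?P G k by unfold_locales (rule k)
  have inv: "pres_class S R [(x, False)] = inv\<^bsub>?P\<^esub> pres_class S R [(x, True)]" if "x \<in> S" for x
    using that pres_eq.cancel[OF that, of R False]
    by (intro P.inv_equality[symmetric])
      (auto simp: presented_mult presented_one presented_carrier pres_class_eq_iff)
  have gen: "pres_class S R [(x, b)] \<in> carrier ?P" if "x \<in> S" for x b
    using that by (auto simp: presented_carrier)
  have "h (pres_class S R w) = k (pres_class S R w)" if "w \<in> words S" for w
    using that
  proof (induction w)
    case Nil
    then show ?case using h.hom_one k.hom_one by (simp add: presented_one)
  next
    case (Cons a w)
    obtain x b where a: "a = (x, b)" by fastforce
    have x: "x \<in> S" and w: "w \<in> words S" using Cons.prems a by auto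
    have "pres_class S R (a # w) = pres_class S R [(x, b)] \<otimes>\<^bsub>?P\<^esub> pres_class S R w"
      using x w a by (simp add: presented_mult)
    moreover have "h (pres_class S R [(x, b)]) = k (pres_class S R [(x, b)])"
      using hk[OF x] inv[OF x] gen[OF x] by (cases b) auto
    moreover have "pres_class S R w \<in> carrier ?P" using w by (auto simp: presented_carrier)
    ultimately show ?case using Cons.IH w gen[OF x] by simp
  qed
  then show ?thesis using x by (auto simp: presented_carrier)
qed

end


section \<open>Outer automorphisms\<close>

definition Inn :: "('a, 'b) monoid_scheme \<Rightarrow> ('a \<Rightarrow> 'a) set" where
  "Inn G = (\<lambda>g. \<lambda>x\<in>carrier G. g \<otimes>\<^bsub>G\<^esub> x \<otimes>\<^bsub>G\<^esub> inv\<^bsub>G\<^esub> g) ` carrier G"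

definition OutGroup :: "('a, 'b) monoid_scheme \<Rightarrow> ('a \<Rightarrow> 'a) set monoid" where
  "OutGroup G = AutoGroup G Mod Inn G"

definition out_class :: "('a, 'b) monoid_scheme \<Rightarrow> ('a \<Rightarrow> 'a) \<Rightarrow> ('a \<Rightarrow> 'a) set" where
  "out_class G f = Inn G #>\<^bsub>AutoGroup G\<^esub> f"

context group
begin

lemma conj_hom: "g \<in> carrier G \<Longrightarrow> (\<lambda>x\<in>carrier G. g \<otimes> x \<otimes> inv g) \<in> hom G G"
  by (rule homI) (auto simp: m_assoc inv_solve_left)

lemma conj_auto:
  assumes g: "g \<in> carrier G"
  shows "(\<lambda>x\<in>carrier G. g \<otimes> x \<otimes> inv g) \<in> auto G"
proof -
  have gg: "g \<otimes> (inv g \<otimes> x) = x" "inv g \<otimes> (g \<otimes> x) = x" if "x \<in> carrier G" for x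
    using g that by (simp_all add: m_assoc[symmetric])
  have "bij_betw (\<lambda>x. g \<otimes> x \<otimes> inv g) (carrier G) (carrier G)"
    by (rule bij_betw_byWitness[where f' = "\<lambda>x. inv g \<otimes> x \<otimes> g"])
      (use g in \<open>auto simp: m_assoc gg\<close>)
  then show ?thesis
    using conj_hom[OF g] by (auto simp: auto_def Bij_def)
qed

lemma Inn_normal: "Inn G \<lhd> AutoGroup G"
proof -
  interpret A: group "AutoGroup G" by (rule AutoGroup)
  have carA: "carrier (AutoGroup G) = auto G" by (simp add: AutoGroup_def)
  have multA: "f \<otimes>\<^bsub>AutoGroup G\<^esub> h = compose (carrier G) f h"
    if "f \<in> auto G" "h \<in> auto G" for f h
    using that by (simp add: AutoGroup_def BijGroup_def auto_def)
  have oneA: "\<one>\<^bsub>AutoGroup G\<^esub> = (\<lambda>x\<in>carrier G. x)"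
    by (simp add: AutoGroup_def BijGroup_def)
  define c where "c g = (\<lambda>x\<in>carrier G. g \<otimes> x \<otimes> inv g)" for g
  have c_auto: "c g \<in> auto G" if "g \<in> carrier G" for g
    using conj_auto[OF that] by (simp add: c_def)
  have Inn: "Inn G = c ` carrier G" by (simp add: Inn_def c_def[abs_def])
  have c_mult: "c g \<otimes>\<^bsub>AutoGroup G\<^esub> c h = c (g \<otimes> h)" if "g \<in> carrier G" "h \<in> carrier G" for g h
    using that
    by (simp add: multA c_auto) (auto simp: c_def compose_def fun_eq_iff m_assoc inv_mult_group)
  have "group_hom G (AutoGroup G) c"
    by unfold_locales (auto intro!: homI simp: carA c_auto c_mult)
  then interpret c: group_hom G "AutoGroup G" c .
  have sub: "subgroup (Inn G) (AutoGroup G)"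
    using c.img_is_subgroup by (simp add: Inn)
  show ?thesis
    unfolding A.normal_inv_iff
  proof (intro conjI sub ballI)
    fix f i assume f: "f \<in> carrier (AutoGroup G)" and "i \<in> Inn G"
    then obtain g where g: "g \<in> carrier G" "i = c g" by (auto simp: Inn)
    have f': "f \<in> auto G" using f carA by simp
    then have fh: "f \<in> hom G G" by (simp add: auto_def)
    interpret f: group_hom G G f by unfold_locales (rule fh)
    have "f \<otimes>\<^bsub>AutoGroup G\<^esub> i = c (f g) \<otimes>\<^bsub>AutoGroup G\<^esub> f"
      using g f' by (simp add: multA c_auto) (auto simp: c_def compose_def fun_eq_iff)
    then have "f \<otimes>\<^bsub>AutoGroup G\<^esub> i \<otimes>\<^bsub>AutoGroup G\<^esub> inv\<^bsub>AutoGroup G\<^esub> f = c (f g)"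
      using f A.inv_solve_right'[of "c (f g)"] g c_auto carA
      by (metis A.inv_closed A.m_assoc A.r_inv A.r_one f.hom_closed)
    then show "f \<otimes>\<^bsub>AutoGroup G\<^esub> i \<otimes>\<^bsub>AutoGroup G\<^esub> inv\<^bsub>AutoGroup G\<^esub> f \<in> Inn G"
      using g by (simp add: Inn)
  qed
qed

end


section \<open>The unrestricted virtual braid group\<close>

datatype uvb_gen = Sg nat | Rh nat

definition uvb_gens :: "nat \<Rightarrow> uvb_gen set" where
  "uvb_gens n = Sg ` {1..<n} \<union> Rh ` {1..<n}"

abbreviation s_letter :: "nat \<Rightarrow> uvb_gen \<times> bool" where
  "s_letter i \<equiv> (Sg i, True)"

abbreviation r_letter :: "nat \<Rightarrow> uvb_gen \<times> bool" where
  "r_letter i \<equiv> (Rh i, True)"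

definition uvb_rels :: "nat \<Rightarrow> (uvb_gen word \<times> uvb_gen word) set" where
  "uvb_rels n =
     {([s_letter i, s_letter (i+1), s_letter i], [s_letter (i+1), s_letter i, s_letter (i+1)])
        | i. 1 \<le> i \<and> i + 1 < n}
   \<union> {([s_letter i, s_letter j], [s_letter j, s_letter i])
        | i j. i \<in> {1..<n} \<and> j \<in> {1..<n} \<and> \<bar>int i - int j\<bar> > 1}
   \<union> {([r_letter i, r_letter (i+1), r_letter i], [r_letter (i+1), r_letter i, r_letter (i+1)])
        | i. 1 \<le> i \<and> i + 1 < n}
   \<union> {([r_letter i, r_letter j], [r_letter j, r_letter i])
        | i j. i \<in> {1..<n} \<and> j \<in> {1..<n} \<and> \<bar>int i - int j\<bar> > 1}
   \<union> {([r_letter i, r_letter i], []) | i. i \<in> {1..<n}}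
   \<union> {([s_letter i, r_letter j], [r_letter j, s_letter i])
        | i j. i \<in> {1..<n} \<and> j \<in> {1..<n} \<and> \<bar>int i - int j\<bar> > 1}
   \<union> {([s_letter i, r_letter (i+1), r_letter i], [r_letter (i+1), r_letter i, s_letter (i+1)])
        | i. 1 \<le> i \<and> i + 1 < n}
   \<union> {([r_letter i, s_letter (i+1), s_letter i], [s_letter (i+1), s_letter i, r_letter (i+1)])
        | i. 1 \<le> i \<and> i + 1 < n}
   \<union> {([r_letter (i+1), s_letter i, s_letter (i+1)], [s_letter i, s_letter (i+1), r_letter i])
        | i. 1 \<le> i \<and> i + 1 < n}"

definition UVB :: "nat \<Rightarrow> uvb_gen word set monoid" where
  "UVB n = presented_group (uvb_gens n) (uvb_rels n)"

definition uvb_sigma :: "nat \<Rightarrow> nat \<Rightarrow> uvb_gen word set" where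
  "uvb_sigma n i = pres_class (uvb_gens n) (uvb_rels n) [s_letter i]"

definition uvb_rho :: "nat \<Rightarrow> nat \<Rightarrow> uvb_gen word set" where
  "uvb_rho n i = pres_class (uvb_gens n) (uvb_rels n) [r_letter i]"

text \<open>Elements of \<^term>\<open>auto G\<close> are extensional, so \<open>THE\<close> picks out a single function; that the
  described automorphisms exist and are unique is shown in \<open>beta_ex1\<close> and \<open>gamma_ex1\<close> below.\<close>

definition uvb_beta :: "nat \<Rightarrow> uvb_gen word set \<Rightarrow> uvb_gen word set" where
  "uvb_beta n = (THE f. f \<in> auto (UVB n) \<and>
     (\<forall>i\<in>{1..<n}. f (uvb_sigma n i) = inv\<^bsub>UVB n\<^esub> (uvb_sigma n i) \<and> f (uvb_rho n i) = uvb_rho n i))"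

definition uvb_gamma :: "nat \<Rightarrow> uvb_gen word set \<Rightarrow> uvb_gen word set" where
  "uvb_gamma n = (THE f. f \<in> auto (UVB n) \<and>
     (\<forall>i\<in>{1..<n}. f (uvb_sigma n i) = uvb_rho n i \<otimes>\<^bsub>UVB n\<^esub> uvb_sigma n i \<otimes>\<^bsub>UVB n\<^esub> uvb_rho n i
        \<and> f (uvb_rho n i) = uvb_rho n i))"

lemma group_UVB: "group (UVB n)"
  by (simp add: UVB_def group_presented_group)

lemma uvb_sigma_closed: "i \<in> {1..<n} \<Longrightarrow> uvb_sigma n i \<in> carrier (UVB n)"
  by (auto simp: uvb_sigma_def UVB_def presented_carrier uvb_gens_def)

lemma uvb_rho_closed: "i \<in> {1..<n} \<Longrightarrow> uvb_rho n i \<in> carrier (UVB n)"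
  by (auto simp: uvb_rho_def UVB_def presented_carrier uvb_gens_def)

text \<open>The defining relations, imposed on a pair of families of elements of an arbitrary group.\<close>

definition uvb_system :: "nat \<Rightarrow> ('h, 'c) monoid_scheme \<Rightarrow> (nat \<Rightarrow> 'h) \<Rightarrow> (nat \<Rightarrow> 'h) \<Rightarrow> bool" where
  "uvb_system n H s r \<longleftrightarrow>
     s \<in> {1..<n} \<rightarrow> carrier H \<and> r \<in> {1..<n} \<rightarrow> carrier H
   \<and> (\<forall>i. 1 \<le> i \<and> i + 1 < n \<longrightarrow>
        s i \<otimes>\<^bsub>H\<^esub> s (i+1) \<otimes>\<^bsub>H\<^esub> s i = s (i+1) \<otimes>\<^bsub>H\<^esub> s i \<otimes>\<^bsub>H\<^esub> s (i+1)
      \<and> r i \<otimes>\<^bsub>H\<^esub> r (i+1) \<otimes>\<^bsub>H\<^esub> r i = r (i+1) \<otimes>\<^bsub>H\<^esub> r i \<otimes>\<^bsub>H\<^esub> r (i+1)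
      \<and> s i \<otimes>\<^bsub>H\<^esub> r (i+1) \<otimes>\<^bsub>H\<^esub> r i = r (i+1) \<otimes>\<^bsub>H\<^esub> r i \<otimes>\<^bsub>H\<^esub> s (i+1)
      \<and> r i \<otimes>\<^bsub>H\<^esub> s (i+1) \<otimes>\<^bsub>H\<^esub> s i = s (i+1) \<otimes>\<^bsub>H\<^esub> s i \<otimes>\<^bsub>H\<^esub> r (i+1)
      \<and> r (i+1) \<otimes>\<^bsub>H\<^esub> s i \<otimes>\<^bsub>H\<^esub> s (i+1) = s i \<otimes>\<^bsub>H\<^esub> s (i+1) \<otimes>\<^bsub>H\<^esub> r i)
   \<and> (\<forall>i\<in>{1..<n}. r i \<otimes>\<^bsub>H\<^esub> r i = \<one>\<^bsub>H\<^esub>)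
   \<and> (\<forall>i\<in>{1..<n}. \<forall>j\<in>{1..<n}. \<bar>int i - int j\<bar> > 1 \<longrightarrow>
        s i \<otimes>\<^bsub>H\<^esub> s j = s j \<otimes>\<^bsub>H\<^esub> s i \<and> r i \<otimes>\<^bsub>H\<^esub> r j = r j \<otimes>\<^bsub>H\<^esub> r i \<and> s i \<otimes>\<^bsub>H\<^esub> r j = r j \<otimes>\<^bsub>H\<^esub> s i)"

lemma UVB_system: "uvb_system n (UVB n) (uvb_sigma n) (uvb_rho n)"
proof -
  let ?S = "uvb_gens n" and ?R = "uvb_rels n"
  have g: "Sg i \<in> ?S" "Rh i \<in> ?S" if "1 \<le> i" "i < n" for i
    using that by (auto simp: uvb_gens_def)
  have eq: "pres_class ?S ?R u = pres_class ?S ?R v"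
    if "(u, v) \<in> ?R" "u \<in> words ?S" "v \<in> words ?S" for u v
    using that by (simp add: pres_class_eq_iff pres_eq.rel)
  show ?thesis
    unfolding uvb_system_def
    apply (intro conjI allI impI ballI)
    apply (auto simp: uvb_sigma_closed uvb_rho_closed)[2]
    apply (simp_all add: uvb_sigma_def uvb_rho_def UVB_def presented_mult presented_one g)
    apply ((rule eq, force simp: uvb_rels_def, simp add: g, simp add: g)+)
    done
qed

lemma UVB_lift:
  assumes H: "group H" and sys: "uvb_system n H s r"
  obtains h where "h \<in> hom (UVB n) H"
    "\<And>i. i \<in> {1..<n} \<Longrightarrow> h (uvb_sigma n i) = s i"
    "\<And>i. i \<in> {1..<n} \<Longrightarrow> h (uvb_rho n i) = r i"
proof -
  interpret H: group H by (rule H)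
  define f where "f = case_uvb_gen s r"
  have cl: "s i \<in> carrier H" "r i \<in> carrier H" if "1 \<le> i" "i < n" for i
    using sys that by (auto simp: uvb_system_def Pi_iff)
  have f: "f \<in> uvb_gens n \<rightarrow> carrier H"
    using cl by (auto simp: f_def uvb_gens_def)
  have R: "word_eval H f u = word_eval H f v" if "(u, v) \<in> uvb_rels n" for u v
    using that unfolding uvb_rels_def
    apply (elim UnE; clarsimp simp: f_def cl H.m_assoc[symmetric])
    using sys unfolding uvb_system_def
    apply simp_all
    done
  obtain h where h: "h \<in> hom (presented_group (uvb_gens n) (uvb_rels n)) H"
    "\<And>x. x \<in> uvb_gens n \<Longrightarrow> h (pres_class (uvb_gens n) (uvb_rels n) [(x, True)]) = f x"
    using H.presented_lift[OF f R] by metis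
  show ?thesis
    by (rule that[of h]) (use h in \<open>auto simp: UVB_def uvb_sigma_def uvb_rho_def uvb_gens_def f_def\<close>)
qed

lemma UVB_hom_eq:
  assumes H: "group H" and "h \<in> hom (UVB n) H" "k \<in> hom (UVB n) H"
    and "\<And>i. i \<in> {1..<n} \<Longrightarrow> h (uvb_sigma n i) = k (uvb_sigma n i)"
    and "\<And>i. i \<in> {1..<n} \<Longrightarrow> h (uvb_rho n i) = k (uvb_rho n i)"
    and "x \<in> carrier (UVB n)"
  shows "h x = k x"
  using assms(2-)
  by (intro group.presented_hom_eq[OF H, of h "uvb_gens n" "uvb_rels n" k x])
    (auto simp: UVB_def uvb_gens_def uvb_sigma_def uvb_rho_def)

lemma UVB_involution_ex1:
  assumes sys: "uvb_system n (UVB n) s (uvb_rho n)"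
    and invol: "\<And>h i. h \<in> hom (UVB n) (UVB n) \<Longrightarrow> i \<in> {1..<n} \<Longrightarrow> h (uvb_sigma n i) = s i \<Longrightarrow>
       h (uvb_rho n i) = uvb_rho n i \<Longrightarrow> h (s i) = uvb_sigma n i"
  shows "\<exists>!f. f \<in> auto (UVB n) \<and>
     (\<forall>i\<in>{1..<n}. f (uvb_sigma n i) = s i \<and> f (uvb_rho n i) = uvb_rho n i)"
proof -
  interpret G: group "UVB n" by (rule group_UVB)
  obtain h where h: "h \<in> hom (UVB n) (UVB n)"
    and hs: "\<And>i. i \<in> {1..<n} \<Longrightarrow> h (uvb_sigma n i) = s i"
    and hr: "\<And>i. i \<in> {1..<n} \<Longrightarrow> h (uvb_rho n i) = uvb_rho n i"
    using UVB_lift[OF group_UVB sys] by blast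
  have cl: "h x \<in> carrier (UVB n)" if "x \<in> carrier (UVB n)" for x
    using h that by (auto simp: hom_def)
  have hh: "h (h x) = x" if "x \<in> carrier (UVB n)" for x
  proof (rule UVB_hom_eq[OF group_UVB _ _ _ _ that])
    show "(\<lambda>x. h (h x)) \<in> hom (UVB n) (UVB n)" "(\<lambda>x. x) \<in> hom (UVB n) (UVB n)"
      using h cl by (auto simp: hom_def)
  qed (simp_all add: hs hr invol[OF h])
  define f where "f = restrict h (carrier (UVB n))"
  have "bij_betw h (carrier (UVB n)) (carrier (UVB n))"
    by (rule bij_betw_byWitness[where f' = h]) (auto simp: hh cl)
  moreover have "f \<in> hom (UVB n) (UVB n)"
    using h by (auto simp: f_def hom_def)
  ultimately have f: "f \<in> auto (UVB n)"
    by (simp add: auto_def Bij_def f_def)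
  have fg: "f (uvb_sigma n i) = s i" "f (uvb_rho n i) = uvb_rho n i" if "i \<in> {1..<n}" for i
    using that hs hr uvb_sigma_closed[OF that] uvb_rho_closed[OF that] by (auto simp: f_def)
  show ?thesis
  proof (rule ex1I[of _ f])
    show "f \<in> auto (UVB n) \<and> (\<forall>i\<in>{1..<n}. f (uvb_sigma n i) = s i \<and> f (uvb_rho n i) = uvb_rho n i)"
      using f fg by blast
  next
    fix k
    assume k: "k \<in> auto (UVB n) \<and>
      (\<forall>i\<in>{1..<n}. k (uvb_sigma n i) = s i \<and> k (uvb_rho n i) = uvb_rho n i)"
    show "k = f"
    proof (rule extensionalityI)
      show "k \<in> extensional (carrier (UVB n))" "f \<in> extensional (carrier (UVB n))"
        using k f by (auto simp: auto_def Bij_def)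
      have hom: "k \<in> hom (UVB n) (UVB n)" "f \<in> hom (UVB n) (UVB n)"
        using k f by (auto simp: auto_def)
      show "k x = f x" if "x \<in> carrier (UVB n)" for x
        by (rule UVB_hom_eq[OF group_UVB hom _ _ that]) (use k fg in metis)+
    qed
  qed
qed

lemma (in group) inv_swap:
  assumes "x \<in> carrier G" "y \<in> carrier G" "z \<in> carrier G" "x \<otimes> y = y \<otimes> z"
  shows "inv x \<otimes> y = y \<otimes> inv z"
proof -
  have "y = inv x \<otimes> (y \<otimes> z)"
    using assms by (metis inv_solve_left m_closed)
  then have "y = (inv x \<otimes> y) \<otimes> z" using assms by (simp add: m_assoc)
  then show ?thesis using assms by (metis inv_closed inv_solve_right m_closed)
qed

lemma uvb_system_change:
  assumes base: "uvb_system n H s0 r" and s: "s \<in> {1..<n} \<rightarrow> carrier H"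
    and c1: "\<And>i. 1 \<le> i \<Longrightarrow> i + 1 < n \<Longrightarrow>
        s i \<otimes>\<^bsub>H\<^esub> s (i+1) \<otimes>\<^bsub>H\<^esub> s i = s (i+1) \<otimes>\<^bsub>H\<^esub> s i \<otimes>\<^bsub>H\<^esub> s (i+1)
      \<and> s i \<otimes>\<^bsub>H\<^esub> r (i+1) \<otimes>\<^bsub>H\<^esub> r i = r (i+1) \<otimes>\<^bsub>H\<^esub> r i \<otimes>\<^bsub>H\<^esub> s (i+1)
      \<and> r i \<otimes>\<^bsub>H\<^esub> s (i+1) \<otimes>\<^bsub>H\<^esub> s i = s (i+1) \<otimes>\<^bsub>H\<^esub> s i \<otimes>\<^bsub>H\<^esub> r (i+1)
      \<and> r (i+1) \<otimes>\<^bsub>H\<^esub> s i \<otimes>\<^bsub>H\<^esub> s (i+1) = s i \<otimes>\<^bsub>H\<^esub> s (i+1) \<otimes>\<^bsub>H\<^esub> r i"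
    and c2: "\<And>i j. i \<in> {1..<n} \<Longrightarrow> j \<in> {1..<n} \<Longrightarrow> \<bar>int i - int j\<bar> > 1 \<Longrightarrow>
        s i \<otimes>\<^bsub>H\<^esub> s j = s j \<otimes>\<^bsub>H\<^esub> s i \<and> s i \<otimes>\<^bsub>H\<^esub> r j = r j \<otimes>\<^bsub>H\<^esub> s i"
  shows "uvb_system n H s r"
proof -
  have b: "r \<in> {1..<n} \<rightarrow> carrier H"
    "\<And>i. 1 \<le> i \<Longrightarrow> i + 1 < n \<Longrightarrow> r i \<otimes>\<^bsub>H\<^esub> r (i+1) \<otimes>\<^bsub>H\<^esub> r i = r (i+1) \<otimes>\<^bsub>H\<^esub> r i \<otimes>\<^bsub>H\<^esub> r (i+1)"
    "\<And>i. i \<in> {1..<n} \<Longrightarrow> r i \<otimes>\<^bsub>H\<^esub> r i = \<one>\<^bsub>H\<^esub>"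
    "\<And>i j. i \<in> {1..<n} \<Longrightarrow> j \<in> {1..<n} \<Longrightarrow> \<bar>int i - int j\<bar> > 1 \<Longrightarrow> r i \<otimes>\<^bsub>H\<^esub> r j = r j \<otimes>\<^bsub>H\<^esub> r i"
    using base unfolding uvb_system_def by blast+
  show ?thesis
    unfolding uvb_system_def
    by (intro conjI allI impI ballI; (elim conjE)?;
        (rule s b c1[THEN conjunct1] c1[THEN conjunct2, THEN conjunct1]
          c1[THEN conjunct2, THEN conjunct2, THEN conjunct1]
          c1[THEN conjunct2, THEN conjunct2, THEN conjunct2]
          c2[THEN conjunct1] c2[THEN conjunct2]; assumption))
qed

lemma UVB_beta_system:
  "uvb_system n (UVB n) (\<lambda>i. inv\<^bsub>UVB n\<^esub> (uvb_sigma n i)) (uvb_rho n)"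
proof -
  interpret G: group "UVB n" by (rule group_UVB)
  note sys = UVB_system[of n, unfolded uvb_system_def]
  let ?s = "uvb_sigma n" and ?r = "uvb_rho n"
  have cl: "?s i \<in> carrier (UVB n)" "?r i \<in> carrier (UVB n)" if "1 \<le> i" "i < n" for i
    using that by (auto simp: uvb_sigma_closed uvb_rho_closed)
  have c1: "inv\<^bsub>UVB n\<^esub> ?s i \<otimes>\<^bsub>UVB n\<^esub> inv\<^bsub>UVB n\<^esub> ?s (i+1) \<otimes>\<^bsub>UVB n\<^esub> inv\<^bsub>UVB n\<^esub> ?s i
        = inv\<^bsub>UVB n\<^esub> ?s (i+1) \<otimes>\<^bsub>UVB n\<^esub> inv\<^bsub>UVB n\<^esub> ?s i \<otimes>\<^bsub>UVB n\<^esub> inv\<^bsub>UVB n\<^esub> ?s (i+1)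
      \<and> inv\<^bsub>UVB n\<^esub> ?s i \<otimes>\<^bsub>UVB n\<^esub> ?r (i+1) \<otimes>\<^bsub>UVB n\<^esub> ?r i = ?r (i+1) \<otimes>\<^bsub>UVB n\<^esub> ?r i \<otimes>\<^bsub>UVB n\<^esub> inv\<^bsub>UVB n\<^esub> ?s (i+1)
      \<and> ?r i \<otimes>\<^bsub>UVB n\<^esub> inv\<^bsub>UVB n\<^esub> ?s (i+1) \<otimes>\<^bsub>UVB n\<^esub> inv\<^bsub>UVB n\<^esub> ?s i
        = inv\<^bsub>UVB n\<^esub> ?s (i+1) \<otimes>\<^bsub>UVB n\<^esub> inv\<^bsub>UVB n\<^esub> ?s i \<otimes>\<^bsub>UVB n\<^esub> ?r (i+1)
      \<and> ?r (i+1) \<otimes>\<^bsub>UVB n\<^esub> inv\<^bsub>UVB n\<^esub> ?s i \<otimes>\<^bsub>UVB n\<^esub> inv\<^bsub>UVB n\<^esub> ?s (i+1)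
        = inv\<^bsub>UVB n\<^esub> ?s i \<otimes>\<^bsub>UVB n\<^esub> inv\<^bsub>UVB n\<^esub> ?s (i+1) \<otimes>\<^bsub>UVB n\<^esub> ?r i"
    if i: "1 \<le> i" "i + 1 < n" for i
  proof -
    define j where "j = i + 1"
    let ?a = "?s i" and ?b = "?s j" and ?p = "?r i" and ?q = "?r j"
    have c: "?a \<in> carrier (UVB n)" "?b \<in> carrier (UVB n)" "?p \<in> carrier (UVB n)" "?q \<in> carrier (UVB n)"
      using cl i by (auto simp: j_def)
    have e: "?a \<otimes>\<^bsub>UVB n\<^esub> ?b \<otimes>\<^bsub>UVB n\<^esub> ?a = ?b \<otimes>\<^bsub>UVB n\<^esub> ?a \<otimes>\<^bsub>UVB n\<^esub> ?b"
      "?a \<otimes>\<^bsub>UVB n\<^esub> ?q \<otimes>\<^bsub>UVB n\<^esub> ?p = ?q \<otimes>\<^bsub>UVB n\<^esub> ?p \<otimes>\<^bsub>UVB n\<^esub> ?b"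
      "?p \<otimes>\<^bsub>UVB n\<^esub> ?b \<otimes>\<^bsub>UVB n\<^esub> ?a = ?b \<otimes>\<^bsub>UVB n\<^esub> ?a \<otimes>\<^bsub>UVB n\<^esub> ?q"
      "?q \<otimes>\<^bsub>UVB n\<^esub> ?a \<otimes>\<^bsub>UVB n\<^esub> ?b = ?a \<otimes>\<^bsub>UVB n\<^esub> ?b \<otimes>\<^bsub>UVB n\<^esub> ?p"
      using sys i unfolding j_def by blast+
    have pq: "inv\<^bsub>UVB n\<^esub> ?p = ?p" "inv\<^bsub>UVB n\<^esub> ?q = ?q"
      by (rule G.inv_equality; use sys i c in \<open>auto simp: j_def\<close>)+
    have "inv\<^bsub>UVB n\<^esub> (?a \<otimes>\<^bsub>UVB n\<^esub> ?b \<otimes>\<^bsub>UVB n\<^esub> ?a) = inv\<^bsub>UVB n\<^esub> (?b \<otimes>\<^bsub>UVB n\<^esub> ?a \<otimes>\<^bsub>UVB n\<^esub> ?b)"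
      "inv\<^bsub>UVB n\<^esub> (?p \<otimes>\<^bsub>UVB n\<^esub> ?b \<otimes>\<^bsub>UVB n\<^esub> ?a) = inv\<^bsub>UVB n\<^esub> (?b \<otimes>\<^bsub>UVB n\<^esub> ?a \<otimes>\<^bsub>UVB n\<^esub> ?q)"
      "inv\<^bsub>UVB n\<^esub> (?q \<otimes>\<^bsub>UVB n\<^esub> ?a \<otimes>\<^bsub>UVB n\<^esub> ?b) = inv\<^bsub>UVB n\<^esub> (?a \<otimes>\<^bsub>UVB n\<^esub> ?b \<otimes>\<^bsub>UVB n\<^esub> ?p)"
      using e by simp_all
    moreover have "inv\<^bsub>UVB n\<^esub> ?a \<otimes>\<^bsub>UVB n\<^esub> (?q \<otimes>\<^bsub>UVB n\<^esub> ?p) = (?q \<otimes>\<^bsub>UVB n\<^esub> ?p) \<otimes>\<^bsub>UVB n\<^esub> inv\<^bsub>UVB n\<^esub> ?b"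
      by (rule G.inv_swap) (use c e(2) in \<open>simp_all add: G.m_assoc\<close>)
    ultimately show ?thesis
      unfolding j_def[symmetric] using c by (simp add: G.inv_mult_group G.m_assoc pq)
  qed
  have far: "inv\<^bsub>UVB n\<^esub> x \<otimes>\<^bsub>UVB n\<^esub> inv\<^bsub>UVB n\<^esub> y = inv\<^bsub>UVB n\<^esub> y \<otimes>\<^bsub>UVB n\<^esub> inv\<^bsub>UVB n\<^esub> x"
    if "x \<in> carrier (UVB n)" "y \<in> carrier (UVB n)" "x \<otimes>\<^bsub>UVB n\<^esub> y = y \<otimes>\<^bsub>UVB n\<^esub> x" for x y
    using that by (metis G.inv_mult_group)
  have c2: "inv\<^bsub>UVB n\<^esub> ?s i \<otimes>\<^bsub>UVB n\<^esub> inv\<^bsub>UVB n\<^esub> ?s j = inv\<^bsub>UVB n\<^esub> ?s j \<otimes>\<^bsub>UVB n\<^esub> inv\<^bsub>UVB n\<^esub> ?s i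
      \<and> inv\<^bsub>UVB n\<^esub> ?s i \<otimes>\<^bsub>UVB n\<^esub> ?r j = ?r j \<otimes>\<^bsub>UVB n\<^esub> inv\<^bsub>UVB n\<^esub> ?s i"
    if i: "i \<in> {1..<n}" and j: "j \<in> {1..<n}" and ij: "\<bar>int i - int j\<bar> > 1" for i j
  proof
    have "?s i \<otimes>\<^bsub>UVB n\<^esub> ?s j = ?s j \<otimes>\<^bsub>UVB n\<^esub> ?s i" and e: "?s i \<otimes>\<^bsub>UVB n\<^esub> ?r j = ?r j \<otimes>\<^bsub>UVB n\<^esub> ?s i"
      using sys i j ij by blast+
    then show "inv\<^bsub>UVB n\<^esub> ?s i \<otimes>\<^bsub>UVB n\<^esub> inv\<^bsub>UVB n\<^esub> ?s j = inv\<^bsub>UVB n\<^esub> ?s j \<otimes>\<^bsub>UVB n\<^esub> inv\<^bsub>UVB n\<^esub> ?s i"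
      using far i j cl by simp
    have ci: "?s i \<in> carrier (UVB n)" and cj: "?r j \<in> carrier (UVB n)"
      using cl i j by auto
    have "inv\<^bsub>UVB n\<^esub> ?s i \<otimes>\<^bsub>UVB n\<^esub> (?s i \<otimes>\<^bsub>UVB n\<^esub> ?r j) \<otimes>\<^bsub>UVB n\<^esub> inv\<^bsub>UVB n\<^esub> ?s i = ?r j \<otimes>\<^bsub>UVB n\<^esub> inv\<^bsub>UVB n\<^esub> ?s i"
      using ci cj by (simp add: G.m_assoc[symmetric])
    moreover have "inv\<^bsub>UVB n\<^esub> ?s i \<otimes>\<^bsub>UVB n\<^esub> (?r j \<otimes>\<^bsub>UVB n\<^esub> ?s i) \<otimes>\<^bsub>UVB n\<^esub> inv\<^bsub>UVB n\<^esub> ?s i = inv\<^bsub>UVB n\<^esub> ?s i \<otimes>\<^bsub>UVB n\<^esub> ?r j"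
      using ci cj by (simp add: G.m_assoc)
    ultimately show "inv\<^bsub>UVB n\<^esub> ?s i \<otimes>\<^bsub>UVB n\<^esub> ?r j = ?r j \<otimes>\<^bsub>UVB n\<^esub> inv\<^bsub>UVB n\<^esub> ?s i"
      using e by simp
  qed
  show ?thesis
    by (rule uvb_system_change[OF UVB_system _ c1 c2]) (use cl in auto)
qed

lemma UVB_gamma_system:
  "uvb_system n (UVB n)
     (\<lambda>i. uvb_rho n i \<otimes>\<^bsub>UVB n\<^esub> uvb_sigma n i \<otimes>\<^bsub>UVB n\<^esub> uvb_rho n i) (uvb_rho n)"
proof -
  interpret G: group "UVB n" by (rule group_UVB)
  note sys = UVB_system[of n, unfolded uvb_system_def]
  let ?s = "uvb_sigma n" and ?r = "uvb_rho n"
  let ?t = "\<lambda>i. ?r i \<otimes>\<^bsub>UVB n\<^esub> ?s i \<otimes>\<^bsub>UVB n\<^esub> ?r i"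
  have cl: "?s i \<in> carrier (UVB n)" "?r i \<in> carrier (UVB n)" if "1 \<le> i" "i < n" for i
    using that by (auto simp: uvb_sigma_closed uvb_rho_closed)
  have c1: "?t i \<otimes>\<^bsub>UVB n\<^esub> ?t (i+1) \<otimes>\<^bsub>UVB n\<^esub> ?t i = ?t (i+1) \<otimes>\<^bsub>UVB n\<^esub> ?t i \<otimes>\<^bsub>UVB n\<^esub> ?t (i+1)
      \<and> ?t i \<otimes>\<^bsub>UVB n\<^esub> ?r (i+1) \<otimes>\<^bsub>UVB n\<^esub> ?r i = ?r (i+1) \<otimes>\<^bsub>UVB n\<^esub> ?r i \<otimes>\<^bsub>UVB n\<^esub> ?t (i+1)
      \<and> ?r i \<otimes>\<^bsub>UVB n\<^esub> ?t (i+1) \<otimes>\<^bsub>UVB n\<^esub> ?t i = ?t (i+1) \<otimes>\<^bsub>UVB n\<^esub> ?t i \<otimes>\<^bsub>UVB n\<^esub> ?r (i+1)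
      \<and> ?r (i+1) \<otimes>\<^bsub>UVB n\<^esub> ?t i \<otimes>\<^bsub>UVB n\<^esub> ?t (i+1) = ?t i \<otimes>\<^bsub>UVB n\<^esub> ?t (i+1) \<otimes>\<^bsub>UVB n\<^esub> ?r i"
    if i: "1 \<le> i" "i + 1 < n" for i
  proof -
    define j where "j = i + 1"
    let ?a = "?s i" and ?b = "?s j" and ?p = "?r i" and ?q = "?r j"
    have c: "?a \<in> carrier (UVB n)" "?b \<in> carrier (UVB n)" "?p \<in> carrier (UVB n)" "?q \<in> carrier (UVB n)"
      using cl i by (auto simp: j_def)
    have e: "?a \<otimes>\<^bsub>UVB n\<^esub> ?b \<otimes>\<^bsub>UVB n\<^esub> ?a = ?b \<otimes>\<^bsub>UVB n\<^esub> ?a \<otimes>\<^bsub>UVB n\<^esub> ?b"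
      "?a \<otimes>\<^bsub>UVB n\<^esub> ?q \<otimes>\<^bsub>UVB n\<^esub> ?p = ?q \<otimes>\<^bsub>UVB n\<^esub> ?p \<otimes>\<^bsub>UVB n\<^esub> ?b"
      "?p \<otimes>\<^bsub>UVB n\<^esub> ?b \<otimes>\<^bsub>UVB n\<^esub> ?a = ?b \<otimes>\<^bsub>UVB n\<^esub> ?a \<otimes>\<^bsub>UVB n\<^esub> ?q"
      "?q \<otimes>\<^bsub>UVB n\<^esub> ?a \<otimes>\<^bsub>UVB n\<^esub> ?b = ?a \<otimes>\<^bsub>UVB n\<^esub> ?b \<otimes>\<^bsub>UVB n\<^esub> ?p"
      "?p \<otimes>\<^bsub>UVB n\<^esub> ?q \<otimes>\<^bsub>UVB n\<^esub> ?p = ?q \<otimes>\<^bsub>UVB n\<^esub> ?p \<otimes>\<^bsub>UVB n\<^esub> ?q"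
      using sys i unfolding j_def by blast+
    have sq: "?p \<otimes>\<^bsub>UVB n\<^esub> ?p = \<one>\<^bsub>UVB n\<^esub>" "?q \<otimes>\<^bsub>UVB n\<^esub> ?q = \<one>\<^bsub>UVB n\<^esub>"
      using sys i by (auto simp: j_def)
    have sq': "?p \<otimes>\<^bsub>UVB n\<^esub> (?p \<otimes>\<^bsub>UVB n\<^esub> x) = x" "?q \<otimes>\<^bsub>UVB n\<^esub> (?q \<otimes>\<^bsub>UVB n\<^esub> x) = x"
      if "x \<in> carrier (UVB n)" for x
      using c sq that by (simp_all add: G.m_assoc[symmetric])
    have swap: "?p \<otimes>\<^bsub>UVB n\<^esub> ?q \<otimes>\<^bsub>UVB n\<^esub> ?a = ?b \<otimes>\<^bsub>UVB n\<^esub> ?p \<otimes>\<^bsub>UVB n\<^esub> ?q"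
    proof -
      have "?p \<otimes>\<^bsub>UVB n\<^esub> ?q \<otimes>\<^bsub>UVB n\<^esub> (?a \<otimes>\<^bsub>UVB n\<^esub> ?q \<otimes>\<^bsub>UVB n\<^esub> ?p) \<otimes>\<^bsub>UVB n\<^esub> (?p \<otimes>\<^bsub>UVB n\<^esub> ?q)
        = ?p \<otimes>\<^bsub>UVB n\<^esub> ?q \<otimes>\<^bsub>UVB n\<^esub> (?q \<otimes>\<^bsub>UVB n\<^esub> ?p \<otimes>\<^bsub>UVB n\<^esub> ?b) \<otimes>\<^bsub>UVB n\<^esub> (?p \<otimes>\<^bsub>UVB n\<^esub> ?q)"
        by (simp only: e(2))
      then show ?thesis using c by (simp add: G.m_assoc sq sq')
    qed
    define w where "w = ?p \<otimes>\<^bsub>UVB n\<^esub> ?q \<otimes>\<^bsub>UVB n\<^esub> ?p"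
    have w: "w \<in> carrier (UVB n)" using c by (simp add: w_def)
    have w': "w = ?q \<otimes>\<^bsub>UVB n\<^esub> ?p \<otimes>\<^bsub>UVB n\<^esub> ?q" using e by (simp add: w_def)
    have ww: "w \<otimes>\<^bsub>UVB n\<^esub> w = \<one>\<^bsub>UVB n\<^esub>" using c by (simp add: w_def G.m_assoc sq sq')
    have ww': "w \<otimes>\<^bsub>UVB n\<^esub> (w \<otimes>\<^bsub>UVB n\<^esub> x) = x" if "x \<in> carrier (UVB n)" for x
      using w ww that by (simp add: G.m_assoc[symmetric])
    define k where "k x = w \<otimes>\<^bsub>UVB n\<^esub> x \<otimes>\<^bsub>UVB n\<^esub> w" for x
    have k: "k x \<otimes>\<^bsub>UVB n\<^esub> k y = k (x \<otimes>\<^bsub>UVB n\<^esub> y)"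
      if "x \<in> carrier (UVB n)" "y \<in> carrier (UVB n)" for x y
      using w that by (simp add: k_def G.m_assoc ww')
    have "k ?b = ?p \<otimes>\<^bsub>UVB n\<^esub> (?q \<otimes>\<^bsub>UVB n\<^esub> ?p \<otimes>\<^bsub>UVB n\<^esub> ?b) \<otimes>\<^bsub>UVB n\<^esub> (?p \<otimes>\<^bsub>UVB n\<^esub> ?q \<otimes>\<^bsub>UVB n\<^esub> ?p)"
      using c by (simp add: k_def w_def G.m_assoc)
    also have "\<dots> = ?t i"
      unfolding e(2)[symmetric] using c by (simp add: G.m_assoc sq sq')
    finally have A: "?t i = k ?b" by simp
    have "k ?a = ?q \<otimes>\<^bsub>UVB n\<^esub> (?p \<otimes>\<^bsub>UVB n\<^esub> ?q \<otimes>\<^bsub>UVB n\<^esub> ?a) \<otimes>\<^bsub>UVB n\<^esub> (?q \<otimes>\<^bsub>UVB n\<^esub> ?p \<otimes>\<^bsub>UVB n\<^esub> ?q)"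
      using c by (simp add: k_def w' G.m_assoc)
    also have "\<dots> = ?t j"
      unfolding swap using c by (simp add: G.m_assoc sq sq')
    finally have B: "?t j = k ?a" by simp
    have "k ?q = ?p"
    proof -
      have "k ?q = (?q \<otimes>\<^bsub>UVB n\<^esub> ?p \<otimes>\<^bsub>UVB n\<^esub> ?q) \<otimes>\<^bsub>UVB n\<^esub> ?q \<otimes>\<^bsub>UVB n\<^esub> (?q \<otimes>\<^bsub>UVB n\<^esub> ?p \<otimes>\<^bsub>UVB n\<^esub> ?q)"
        by (simp add: k_def w')
      also have "\<dots> = ?q \<otimes>\<^bsub>UVB n\<^esub> (?p \<otimes>\<^bsub>UVB n\<^esub> ?q \<otimes>\<^bsub>UVB n\<^esub> ?p) \<otimes>\<^bsub>UVB n\<^esub> ?q"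
        using c by (simp add: G.m_assoc sq sq')
      also have "\<dots> = ?p" unfolding e(5) using c by (simp add: G.m_assoc sq sq')
      finally show ?thesis .
    qed
    moreover have "k ?p = ?q"
    proof -
      have "k ?p = ?p \<otimes>\<^bsub>UVB n\<^esub> (?q \<otimes>\<^bsub>UVB n\<^esub> ?p \<otimes>\<^bsub>UVB n\<^esub> ?q) \<otimes>\<^bsub>UVB n\<^esub> ?p"
        using c by (simp add: k_def w_def G.m_assoc sq sq')
      also have "\<dots> = ?q" unfolding e(5)[symmetric] using c by (simp add: G.m_assoc sq sq')
      finally show ?thesis .
    qed
    ultimately have P: "?p = k ?q" "?q = k ?p" by simp_all
    have "k ?b \<otimes>\<^bsub>UVB n\<^esub> k ?a \<otimes>\<^bsub>UVB n\<^esub> k ?b = k ?a \<otimes>\<^bsub>UVB n\<^esub> k ?b \<otimes>\<^bsub>UVB n\<^esub> k ?a"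
      "k ?b \<otimes>\<^bsub>UVB n\<^esub> k ?p \<otimes>\<^bsub>UVB n\<^esub> k ?q = k ?p \<otimes>\<^bsub>UVB n\<^esub> k ?q \<otimes>\<^bsub>UVB n\<^esub> k ?a"
      "k ?q \<otimes>\<^bsub>UVB n\<^esub> k ?a \<otimes>\<^bsub>UVB n\<^esub> k ?b = k ?a \<otimes>\<^bsub>UVB n\<^esub> k ?b \<otimes>\<^bsub>UVB n\<^esub> k ?p"
      "k ?p \<otimes>\<^bsub>UVB n\<^esub> k ?b \<otimes>\<^bsub>UVB n\<^esub> k ?a = k ?b \<otimes>\<^bsub>UVB n\<^esub> k ?a \<otimes>\<^bsub>UVB n\<^esub> k ?q"
      using c e swap by (simp_all add: k)
    then show ?thesis unfolding j_def[symmetric] A B P[symmetric] by blast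
  qed
  have c2: "?t i \<otimes>\<^bsub>UVB n\<^esub> ?t j = ?t j \<otimes>\<^bsub>UVB n\<^esub> ?t i \<and> ?t i \<otimes>\<^bsub>UVB n\<^esub> ?r j = ?r j \<otimes>\<^bsub>UVB n\<^esub> ?t i"
    if i: "i \<in> {1..<n}" and j: "j \<in> {1..<n}" and ij: "\<bar>int i - int j\<bar> > 1" for i j
  proof -
    have comm: "(x \<otimes>\<^bsub>UVB n\<^esub> y) \<otimes>\<^bsub>UVB n\<^esub> z = z \<otimes>\<^bsub>UVB n\<^esub> (x \<otimes>\<^bsub>UVB n\<^esub> y)"
      if "x \<in> carrier (UVB n)" "y \<in> carrier (UVB n)" "z \<in> carrier (UVB n)"
        "x \<otimes>\<^bsub>UVB n\<^esub> z = z \<otimes>\<^bsub>UVB n\<^esub> x" "y \<otimes>\<^bsub>UVB n\<^esub> z = z \<otimes>\<^bsub>UVB n\<^esub> y" for x y z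
      using that by (metis G.m_assoc)
    have c: "?s i \<in> carrier (UVB n)" "?r i \<in> carrier (UVB n)" "?s j \<in> carrier (UVB n)" "?r j \<in> carrier (UVB n)"
      using cl i j by auto
    have e: "?s i \<otimes>\<^bsub>UVB n\<^esub> ?s j = ?s j \<otimes>\<^bsub>UVB n\<^esub> ?s i" "?r i \<otimes>\<^bsub>UVB n\<^esub> ?r j = ?r j \<otimes>\<^bsub>UVB n\<^esub> ?r i"
      "?s i \<otimes>\<^bsub>UVB n\<^esub> ?r j = ?r j \<otimes>\<^bsub>UVB n\<^esub> ?s i" 
      using sys i j ij by blast+
    have "\<bar>int j - int i\<bar> > 1" using ij by simp
    then have e': "?s j \<otimes>\<^bsub>UVB n\<^esub> ?r i = ?r i \<otimes>\<^bsub>UVB n\<^esub> ?s j"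
      using sys i j by blast
    have tr: "?t i \<otimes>\<^bsub>UVB n\<^esub> ?r j = ?r j \<otimes>\<^bsub>UVB n\<^esub> ?t i"
      by (intro comm G.m_closed c e)
    have ts: "?t i \<otimes>\<^bsub>UVB n\<^esub> ?s j = ?s j \<otimes>\<^bsub>UVB n\<^esub> ?t i"
      by (intro comm G.m_closed c e e'[symmetric])
    have "?t j \<otimes>\<^bsub>UVB n\<^esub> ?t i = ?t i \<otimes>\<^bsub>UVB n\<^esub> ?t j"
      by (intro comm G.m_closed c tr[symmetric] ts[symmetric])
    with tr show ?thesis by simp
  qed
  show ?thesis
    by (rule uvb_system_change[OF UVB_system _ c1 c2]) (use cl in auto)
qed

lemma beta_ex1:
  "\<exists>!f. f \<in> auto (UVB n) \<and>
     (\<forall>i\<in>{1..<n}. f (uvb_sigma n i) = inv\<^bsub>UVB n\<^esub> (uvb_sigma n i) \<and> f (uvb_rho n i) = uvb_rho n i)"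
proof (rule UVB_involution_ex1[OF UVB_beta_system])
  fix h i
  assume h: "h \<in> hom (UVB n) (UVB n)" and i: "i \<in> {1..<n}"
    and hi: "h (uvb_sigma n i) = inv\<^bsub>UVB n\<^esub> (uvb_sigma n i)"
  interpret G: group "UVB n" by (rule group_UVB)
  interpret h: group_hom "UVB n" "UVB n" h by unfold_locales (rule h)
  show "h (inv\<^bsub>UVB n\<^esub> (uvb_sigma n i)) = uvb_sigma n i"
    using uvb_sigma_closed[OF i] hi by simp
qed

lemma gamma_ex1:
  "\<exists>!f. f \<in> auto (UVB n) \<and>
     (\<forall>i\<in>{1..<n}. f (uvb_sigma n i) = uvb_rho n i \<otimes>\<^bsub>UVB n\<^esub> uvb_sigma n i \<otimes>\<^bsub>UVB n\<^esub> uvb_rho n i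
        \<and> f (uvb_rho n i) = uvb_rho n i)"
proof (rule UVB_involution_ex1[OF UVB_gamma_system])
  fix h i
  assume h: "h \<in> hom (UVB n) (UVB n)" and i: "i \<in> {1..<n}"
    and hi: "h (uvb_sigma n i) = uvb_rho n i \<otimes>\<^bsub>UVB n\<^esub> uvb_sigma n i \<otimes>\<^bsub>UVB n\<^esub> uvb_rho n i"
      "h (uvb_rho n i) = uvb_rho n i"
  interpret G: group "UVB n" by (rule group_UVB)
  interpret h: group_hom "UVB n" "UVB n" h by unfold_locales (rule h)
  have sq: "uvb_rho n i \<otimes>\<^bsub>UVB n\<^esub> uvb_rho n i = \<one>\<^bsub>UVB n\<^esub>"
    using UVB_system[of n] i by (simp add: uvb_system_def)
  then have "uvb_rho n i \<otimes>\<^bsub>UVB n\<^esub> (uvb_rho n i \<otimes>\<^bsub>UVB n\<^esub> x) = x" if "x \<in> carrier (UVB n)" for x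
    using that uvb_rho_closed[OF i] by (simp add: G.m_assoc[symmetric])
  then show "h (uvb_rho n i \<otimes>\<^bsub>UVB n\<^esub> uvb_sigma n i \<otimes>\<^bsub>UVB n\<^esub> uvb_rho n i) = uvb_sigma n i"
    using uvb_sigma_closed[OF i] uvb_rho_closed[OF i] hi sq by (simp add: G.m_assoc)
qed

lemmas uvb_beta_spec = theI'[OF beta_ex1, folded uvb_beta_def]
lemmas uvb_gamma_spec = theI'[OF gamma_ex1, folded uvb_gamma_def]

end

theory Submission
  imports Defs
begin

text \<open>
  On generators \<open>\<beta>\<close> and \<open>\<gamma>\<close> are visibly commuting involutions, so their classes generate a
  quotient of the Klein four-group, and everything hinges on showing that none of \<open>\<beta>\<close>, \<open>\<gamma>\<close> and
  \<open>\<beta>\<gamma>\<close> is inner.  A single representation does this for all three.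

  The kernel of the map \<open>UVB\<^sub>n \<rightarrow> S\<^sub>n\<close>, \<open>\<sigma>\<^sub>i, \<rho>\<^sub>i \<mapsto> (i i+1)\<close>, is generated by elements \<open>x\<^sub>a\<^sub>b\<close>, one for each
  ordered pair of distinct strands, which \<open>S\<^sub>n\<close> permutes by its action on the indices.  Abelianising the
  kernel keeps the \<open>x\<^sub>a\<^sub>b\<close> independent, which gives a homomorphism from \<open>UVB\<^sub>n\<close> to the semidirect product
  of permutations with integer labellings of the ordered pairs (\<open>labelled_perms\<close>, \<open>UVB_system_labelled_perms\<close>):
  \<open>\<sigma>\<^sub>i\<close> goes to the transposition with label 1 at \<open>(i, i+1)\<close>, and \<open>\<rho>\<^sub>i\<close> to the transposition with
  all labels 0.

  Let an automorphism that fixes every \<open>\<rho>\<^sub>i\<close> be conjugation by \<open>g\<close>.  The permutation of \<open>g\<close> then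
  commutes with \<open>(1 2)\<close> and \<open>(2 3)\<close>, hence fixes 1 and 2; this is where \<open>n \<ge> 3\<close> enters, since for two
  strands \<open>(1 2)\<close> itself is central and \<open>\<gamma>\<close> is conjugation by \<open>\<rho>\<^sub>1\<close>.  The labels of \<open>g\<close> are moreover
  symmetric in 1 and 2.  So conjugation by \<open>g\<close> cannot move or change the label 1 that \<open>\<sigma>\<^sub>1\<close> has
  at \<open>(1, 2)\<close> (\<open>label_of_conjugate\<close>).  But \<open>\<gamma>\<close> moves this label to \<open>(2, 1)\<close>, and
  \<open>\<beta>\<close> moves it there and negates it, so both leave 0 at \<open>(1, 2)\<close>; and \<open>\<beta>\<gamma>\<close> changes it to \<open>-1\<close>.
\<close>

section \<open>Klein four-groups inside a group\<close>

context group
begin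

lemma generate_commuting_involutions:
  assumes x: "x \<in> carrier G" and y: "y \<in> carrier G"
    and xx: "x \<otimes> x = \<one>" and yy: "y \<otimes> y = \<one>" and xy: "x \<otimes> y = y \<otimes> x"
  shows "generate G {x, y} = {\<one>, x, y, x \<otimes> y}"
proof
  have red: "x \<otimes> (x \<otimes> z) = z" "y \<otimes> (y \<otimes> z) = z" "y \<otimes> (x \<otimes> z) = x \<otimes> (y \<otimes> z)"
    if "z \<in> carrier G" for z
    using that x y xx yy xy by (simp_all add: m_assoc[symmetric])
  note rules = x y xx yy xy[symmetric] red m_assoc
  have invs: "inv x = x" "inv y = y" "inv (x \<otimes> y) = x \<otimes> y"
    by (rule inv_equality; simp add: rules)+
  have "subgroup {\<one>, x, y, x \<otimes> y} G"
    by (rule subgroupI) (auto simp: rules invs)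
  then show "generate G {x, y} \<subseteq> {\<one>, x, y, x \<otimes> y}"
    by (rule generate_subgroup_incl[rotated]) auto
  show "{\<one>, x, y, x \<otimes> y} \<subseteq> generate G {x, y}"
    by (auto intro: generate.intros)
qed

lemma generate_commuting_involutions_iso:
  assumes x: "x \<in> carrier G" and y: "y \<in> carrier G"
    and xx: "x \<otimes> x = \<one>" and yy: "y \<otimes> y = \<one>" and xy: "x \<otimes> y = y \<otimes> x"
    and x1: "x \<noteq> \<one>" and y1: "y \<noteq> \<one>" and xy1: "x \<otimes> y \<noteq> \<one>"
  shows "G\<lparr>carrier := generate G {x, y}\<rparr> \<cong> integer_mod_group 2 \<times>\<times> integer_mod_group 2"
proof -
  let ?Z = "integer_mod_group 2 \<times>\<times> integer_mod_group 2"
  define f :: "int \<times> int \<Rightarrow> 'a" where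
    "f p = (if fst p = 0 then \<one> else x) \<otimes> (if snd p = 0 then \<one> else y)" for p
  have Z: "carrier ?Z = {0, 1} \<times> {0, 1}"
    by (auto simp: carrier_integer_mod_group)
  have red: "x \<otimes> (x \<otimes> z) = z" "y \<otimes> (y \<otimes> z) = z" "y \<otimes> (x \<otimes> z) = x \<otimes> (y \<otimes> z)"
    if "z \<in> carrier G" for z
    using that x y xx yy xy by (simp_all add: m_assoc[symmetric])
  note rules = x y xx yy xy[symmetric] red m_assoc
  have ne: "x \<noteq> y" using xx xy1 by auto
  have gen: "generate G {x, y} = {\<one>, x, y, x \<otimes> y}"
    by (rule generate_commuting_involutions) fact+
  have "f \<in> hom ?Z (G\<lparr>carrier := generate G {x, y}\<rparr>)"
    by (rule homI; unfold Z) (auto simp: gen f_def rules)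
  moreover have "bij_betw f (carrier ?Z) (generate G {x, y})"
    unfolding Z gen bij_betw_def
  proof
    have "x \<otimes> y \<noteq> x" "x \<otimes> y \<noteq> y"
      using x y x1 y1 by (simp_all add: l_cancel_one r_cancel_one)
    then show "inj_on f ({0, 1} \<times> {0, 1})"
      using x1 y1 xy1 ne x y by (auto simp: inj_on_def f_def dest: sym)
    show "f ` ({0, 1} \<times> {0, 1}) = {\<one>, x, y, x \<otimes> y}"
      using x y by (force simp: f_def)
  qed
  ultimately have iso: "?Z \<cong> G\<lparr>carrier := generate G {x, y}\<rparr>"
    by (intro is_isoI isoI) simp_all
  have "group ?Z" by (simp add: DirProd_group)
  then show ?thesis by (rule group.iso_sym[OF _ iso])
qed

end


section \<open>Outer classes of automorphisms\<close>

context group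
begin

lemma carrier_AutoGroup: "carrier (AutoGroup G) = auto G"
  by (simp add: AutoGroup_def)

lemma one_AutoGroup: "\<one>\<^bsub>AutoGroup G\<^esub> = (\<lambda>x\<in>carrier G. x)"
  by (simp add: AutoGroup_def BijGroup_def)

lemma mult_AutoGroup:
  "f \<in> auto G \<Longrightarrow> h \<in> auto G \<Longrightarrow> f \<otimes>\<^bsub>AutoGroup G\<^esub> h = compose (carrier G) f h"
  by (simp add: AutoGroup_def BijGroup_def auto_def)

lemma group_OutGroup: "group (OutGroup G)"
  unfolding OutGroup_def by (rule normal.factorgroup_is_group[OF Inn_normal])

lemma out_class_hom: "out_class G \<in> hom (AutoGroup G) (OutGroup G)"
  using normal.r_coset_hom_Mod[OF Inn_normal]
  by (simp add: out_class_def[abs_def] OutGroup_def)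

lemma out_class_eq_one_iff:
  assumes f: "f \<in> auto G"
  shows "out_class G f = \<one>\<^bsub>OutGroup G\<^esub> \<longleftrightarrow> f \<in> Inn G"
proof -
  interpret A: group "AutoGroup G" by (rule AutoGroup)
  have sub: "subgroup (Inn G) (AutoGroup G)"
    by (rule normal_imp_subgroup[OF Inn_normal])
  have "Inn G #>\<^bsub>AutoGroup G\<^esub> f = Inn G \<longleftrightarrow> f \<in> Inn G"
    using A.coset_join1[OF _ _ sub] A.coset_join2[OF _ sub] f carrier_AutoGroup by metis
  then show ?thesis by (simp add: out_class_def OutGroup_def FactGroup_def)
qed

end


section \<open>Labelled permutations\<close>

text \<open>Pairs of a permutation and an integer labelling of the ordered pairs of points.  The labelling
  \<open>v\<close> of \<open>(p, v)\<close> is the charge collected by a pair of points when \<open>p\<close> is applied to it; composing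
  two such moves adds the charges, the second one read off at the moved pair.\<close>

definition labelled_perms :: "((nat \<Rightarrow> nat) \<times> (nat \<Rightarrow> nat \<Rightarrow> int)) monoid" where
  "labelled_perms =
    \<lparr>carrier = {p. bij p} \<times> UNIV,
     monoid.mult = (\<lambda>(p, v) (q, w). (p \<circ> q, \<lambda>a b. w a b + v (q a) (q b))),
     one = (id, \<lambda>_ _. 0)\<rparr>"

lemma labelled_perms_simps [simp]:
  "x \<in> carrier labelled_perms \<longleftrightarrow> bij (fst x)"
  "(p, v) \<otimes>\<^bsub>labelled_perms\<^esub> (q, w) = (p \<circ> q, \<lambda>a b. w a b + v (q a) (q b))"
  "\<one>\<^bsub>labelled_perms\<^esub> = (id, \<lambda>_ _. 0)"
  by (auto simp: labelled_perms_def mem_Times_iff)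

lemma group_labelled_perms: "group labelled_perms"
proof (rule groupI)
  fix x assume "x \<in> carrier labelled_perms"
  then obtain p v where x: "x = (p, v)" "bij p" by (cases x) auto
  let ?q = "inv_into UNIV p"
  let ?y = "(?q, \<lambda>a b. - v (?q a) (?q b))"
  have "?y \<in> carrier labelled_perms" "?y \<otimes>\<^bsub>labelled_perms\<^esub> x = \<one>\<^bsub>labelled_perms\<^esub>"
    using x by (auto simp: bij_imp_bij_inv bij_is_inj)
  then show "\<exists>y\<in>carrier labelled_perms. y \<otimes>\<^bsub>labelled_perms\<^esub> x = \<one>\<^bsub>labelled_perms\<^esub>"
    by blast
qed (auto simp: bij_comp comp_assoc add.assoc)

definition sigma_image :: "nat \<Rightarrow> (nat \<Rightarrow> nat) \<times> (nat \<Rightarrow> nat \<Rightarrow> int)" where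
  "sigma_image i = (transpose i (i+1), \<lambda>a b. if a = i \<and> b = i+1 then 1 else 0)"

definition rho_image :: "nat \<Rightarrow> (nat \<Rightarrow> nat) \<times> (nat \<Rightarrow> nat \<Rightarrow> int)" where
  "rho_image i = (transpose i (i+1), \<lambda>_ _. 0)"

text \<open>In each cubic relation both sides carry the same pairs with label 1: for the braid relation,
  for example, these are \<open>(i, i+1)\<close>, \<open>(i, i+2)\<close> and \<open>(i+1, i+2)\<close>, collected in opposite orders.\<close>

lemma UVB_system_labelled_perms: "uvb_system n labelled_perms sigma_image rho_image"
  unfolding uvb_system_def
  by (intro conjI allI impI ballI)
    (auto simp: sigma_image_def rho_image_def fun_eq_iff transpose_def)

lemma commutes_transpositions_fixes:
  fixes p :: "nat \<Rightarrow> nat"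
  assumes p: "bij p"
    and 1: "p \<circ> transpose 1 2 = transpose 1 2 \<circ> p" and 2: "p \<circ> transpose 2 3 = transpose 2 3 \<circ> p"
  shows "p 1 = 1" "p 2 = 2"
proof -
  have inj: "p a = p b \<longleftrightarrow> a = b" for a b using p by (simp add: bij_is_inj inj_eq)
  \<comment> \<open>A permutation commuting with a transposition preserves the pair of points it moves, so \<open>p\<close>
    preserves \<open>{1, 2}\<close> and \<open>{2, 3}\<close>, and 2 is the only common point.\<close>
  have "p 2 = transpose 1 2 (p 1)" "p 2 = transpose 2 3 (p 3)"
    using fun_cong[OF 1, of 1] fun_cong[OF 2, of 3] by (simp_all add: transpose_def)
  then show "p 1 = 1" "p 2 = 2"
    using inj[of 2 1] inj[of 2 3] by (auto simp: transpose_def split: if_splits)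
qed

text \<open>The last hypothesis says that \<open>y\<close> is the conjugate of the image of \<open>\<sigma>\<^sub>1\<close> by \<open>g\<close>.  As the
  permutation of \<open>g\<close> fixes 1 and 2, the two sides of this equation have at \<open>(1, 2)\<close> the labels \<open>1 + v(2, 1)\<close> and \<open>v(1, 2) + w(1, 2)\<close>, where \<open>v\<close> and \<open>w\<close> label \<open>g\<close> and \<open>y\<close>,
  and commuting with the image of \<open>\<rho>\<^sub>1\<close> forces \<open>v(1, 2) = v(2, 1)\<close>.\<close>

lemma label_of_conjugate:
  assumes g: "g \<in> carrier labelled_perms"
    and r1: "g \<otimes>\<^bsub>labelled_perms\<^esub> rho_image 1 = rho_image 1 \<otimes>\<^bsub>labelled_perms\<^esub> g"
    and r2: "g \<otimes>\<^bsub>labelled_perms\<^esub> rho_image 2 = rho_image 2 \<otimes>\<^bsub>labelled_perms\<^esub> g"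
    and s: "g \<otimes>\<^bsub>labelled_perms\<^esub> sigma_image 1 = y \<otimes>\<^bsub>labelled_perms\<^esub> g"
  shows "snd y 1 2 = 1"
proof -
  obtain p v where gpv: "g = (p, v)" by (cases g)
  obtain q w where y: "y = (q, w)" by (cases y)
  have p: "p 1 = 1" "p 2 = 2"
    by (rule commutes_transpositions_fixes[of p];
        use g r1 r2 in \<open>simp add: gpv rho_image_def eval_nat_numeral\<close>)+
  have "v (transpose 1 2 a) (transpose 1 2 b) = v a b" for a b
    using r1 by (auto simp: gpv rho_image_def fun_eq_iff eval_nat_numeral)
  from this[of 1 2] have sym: "v 2 1 = v 1 2" by simp
  have "snd (g \<otimes>\<^bsub>labelled_perms\<^esub> sigma_image 1) 1 2 = snd (y \<otimes>\<^bsub>labelled_perms\<^esub> g) 1 2"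
    by (simp only: s)
  then have "1 + v 2 1 = v 1 2 + w (p 1) (p 2)"
    by (simp add: gpv y sigma_image_def numeral_2_eq_2 del: One_nat_def)
  then show ?thesis using sym p y by simp
qed


section \<open>Automorphisms of the unrestricted virtual braid group\<close>

lemma UVB_auto_eqI:
  assumes f: "f \<in> auto (UVB n)" and k: "k \<in> auto (UVB n)"
    and "\<And>i. i \<in> {1..<n} \<Longrightarrow> f (uvb_sigma n i) = k (uvb_sigma n i)"
    and "\<And>i. i \<in> {1..<n} \<Longrightarrow> f (uvb_rho n i) = k (uvb_rho n i)"
  shows "f = k"
proof (rule extensionalityI)
  show "f \<in> extensional (carrier (UVB n))" "k \<in> extensional (carrier (UVB n))"
    using f k by (auto simp: auto_def Bij_def)
  show "f x = k x" if "x \<in> carrier (UVB n)" for x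
    by (rule UVB_hom_eq[OF group_UVB _ _ _ _ that]) (use assms in \<open>auto simp: auto_def\<close>)
qed

lemma not_inner_if_label:
  assumes n: "n \<ge> 3" and h: "h \<in> hom (UVB n) labelled_perms"
    and hs: "\<And>i. i \<in> {1..<n} \<Longrightarrow> h (uvb_sigma n i) = sigma_image i"
    and hr: "\<And>i. i \<in> {1..<n} \<Longrightarrow> h (uvb_rho n i) = rho_image i"
    and fr: "\<And>i. i \<in> {1..<n} \<Longrightarrow> f (uvb_rho n i) = uvb_rho n i"
    and label: "snd (h (f (uvb_sigma n 1))) 1 2 \<noteq> 1"
  shows "f \<notin> Inn (UVB n)"
proof
  assume "f \<in> Inn (UVB n)"
  interpret G: group "UVB n" by (rule group_UVB)
  interpret L: group labelled_perms by (rule group_labelled_perms)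
  interpret h: group_hom "UVB n" labelled_perms h by unfold_locales (rule h)
  obtain g where g: "g \<in> carrier (UVB n)"
    and f: "f = (\<lambda>x\<in>carrier (UVB n). g \<otimes>\<^bsub>UVB n\<^esub> x \<otimes>\<^bsub>UVB n\<^esub> inv\<^bsub>UVB n\<^esub> g)"
    using \<open>f \<in> Inn (UVB n)\<close> by (auto simp: Inn_def)
  have conj: "h g \<otimes>\<^bsub>labelled_perms\<^esub> h x = h (f x) \<otimes>\<^bsub>labelled_perms\<^esub> h g"
    if x: "x \<in> carrier (UVB n)" for x
  proof -
    have "f x \<in> carrier (UVB n)" "g \<otimes>\<^bsub>UVB n\<^esub> x = f x \<otimes>\<^bsub>UVB n\<^esub> g"
      using g x by (auto simp: f G.m_assoc)
    then show ?thesis using g x by (metis h.hom_mult)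
  qed
  have "snd (h (f (uvb_sigma n 1))) 1 2 = 1"
  proof (rule label_of_conjugate)
    show "h g \<in> carrier labelled_perms" using g by (rule h.hom_closed)
    show "h g \<otimes>\<^bsub>labelled_perms\<^esub> rho_image 1 = rho_image 1 \<otimes>\<^bsub>labelled_perms\<^esub> h g"
      using conj[OF uvb_rho_closed, of 1] n hr[of 1] fr[of 1] by simp
    show "h g \<otimes>\<^bsub>labelled_perms\<^esub> rho_image 2 = rho_image 2 \<otimes>\<^bsub>labelled_perms\<^esub> h g"
      using conj[OF uvb_rho_closed, of 2] n hr[of 2] fr[of 2] by simp
    show "h g \<otimes>\<^bsub>labelled_perms\<^esub> sigma_image 1
        = h (f (uvb_sigma n 1)) \<otimes>\<^bsub>labelled_perms\<^esub> h g"
      using conj[OF uvb_sigma_closed, of 1] n hs[of 1] by simp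
  qed
  with label show False by contradiction
qed

theorem proposition4:
  fixes n :: nat
  assumes "n \<ge> 3"
  shows "subgroup (generate (OutGroup (UVB n)) {out_class (UVB n) (uvb_beta n), out_class (UVB n) (uvb_gamma n)})
           (OutGroup (UVB n))
    \<and> (OutGroup (UVB n))\<lparr>carrier :=
          generate (OutGroup (UVB n)) {out_class (UVB n) (uvb_beta n), out_class (UVB n) (uvb_gamma n)}\<rparr>
        \<cong> integer_mod_group 2 \<times>\<times> integer_mod_group 2"
proof -
  let ?G = "UVB n"
  interpret G: group ?G by (rule group_UVB)
  interpret A: group "AutoGroup ?G" by (rule G.AutoGroup)
  interpret Out: group "OutGroup ?G" by (rule G.group_OutGroup)
  interpret C: group_hom "AutoGroup ?G" "OutGroup ?G" "out_class ?G"
    by unfold_locales (rule G.out_class_hom)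
  let ?s = "uvb_sigma n" and ?r = "uvb_rho n" and ?b = "uvb_beta n" and ?c = "uvb_gamma n"
  let ?bc = "?b \<otimes>\<^bsub>AutoGroup ?G\<^esub> ?c"
  note cl = uvb_sigma_closed uvb_rho_closed
  have b: "?b \<in> auto ?G" and c: "?c \<in> auto ?G"
    using uvb_beta_spec uvb_gamma_spec by blast+
  have bs: "?b (?s i) = inv\<^bsub>?G\<^esub> (?s i)" and br: "?b (?r i) = ?r i"
    and cs: "?c (?s i) = ?r i \<otimes>\<^bsub>?G\<^esub> ?s i \<otimes>\<^bsub>?G\<^esub> ?r i" and cr: "?c (?r i) = ?r i"
    if "i \<in> {1..<n}" for i
    using uvb_beta_spec[of n] uvb_gamma_spec[of n] that by auto
  have rr: "?r i \<otimes>\<^bsub>?G\<^esub> ?r i = \<one>\<^bsub>?G\<^esub>" if "i \<in> {1..<n}" for i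
    using UVB_system[of n] that by (simp add: uvb_system_def)
  have rr': "?r i \<otimes>\<^bsub>?G\<^esub> (?r i \<otimes>\<^bsub>?G\<^esub> z) = z" if "i \<in> {1..<n}" "z \<in> carrier ?G" for i z
    using rr[OF that(1)] that by (simp add: G.m_assoc[symmetric] cl)
  have rinv: "inv\<^bsub>?G\<^esub> (?r i) = ?r i" if "i \<in> {1..<n}" for i
    using rr[OF that] that by (intro G.inv_equality) (simp_all add: cl)
  interpret b: group_hom ?G ?G ?b
    using b by unfold_locales (simp add: auto_def)
  interpret c: group_hom ?G ?G ?c
    using c by unfold_locales (simp add: auto_def)
  note mult = G.mult_AutoGroup compose_def
  have prods: "?b \<otimes>\<^bsub>AutoGroup ?G\<^esub> ?b \<in> auto ?G" "?c \<otimes>\<^bsub>AutoGroup ?G\<^esub> ?c \<in> auto ?G"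
    "?b \<otimes>\<^bsub>AutoGroup ?G\<^esub> ?c \<in> auto ?G" "?c \<otimes>\<^bsub>AutoGroup ?G\<^esub> ?b \<in> auto ?G"
    "\<one>\<^bsub>AutoGroup ?G\<^esub> \<in> auto ?G"
    using A.m_closed A.one_closed b c unfolding G.carrier_AutoGroup by blast+
  have bb: "?b \<otimes>\<^bsub>AutoGroup ?G\<^esub> ?b = \<one>\<^bsub>AutoGroup ?G\<^esub>"
    by (rule UVB_auto_eqI[OF prods(1,5)]) (simp_all add: mult b G.one_AutoGroup cl bs br)
  have cc: "?c \<otimes>\<^bsub>AutoGroup ?G\<^esub> ?c = \<one>\<^bsub>AutoGroup ?G\<^esub>"
    by (rule UVB_auto_eqI[OF prods(2,5)])
      (simp_all add: mult c G.one_AutoGroup cl cs cr rr rr' G.m_assoc)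
  have bc: "?bc = ?c \<otimes>\<^bsub>AutoGroup ?G\<^esub> ?b"
    by (rule UVB_auto_eqI[OF prods(3,4)])
      (simp_all add: mult b c cl bs br cs cr rinv G.inv_mult_group G.m_assoc)

  obtain h where h: "h \<in> hom ?G labelled_perms"
    and hs: "\<And>i. i \<in> {1..<n} \<Longrightarrow> h (?s i) = sigma_image i"
    and hr: "\<And>i. i \<in> {1..<n} \<Longrightarrow> h (?r i) = rho_image i"
    using UVB_lift[OF group_labelled_perms UVB_system_labelled_perms] by blast
  interpret L: group labelled_perms by (rule group_labelled_perms)
  interpret h: group_hom ?G labelled_perms h by unfold_locales (rule h)
  have one: "1 \<in> {1..<n}" using assms by simp
  \<comment> \<open>A label sits at a pair before the move, so inverting \<open>\<sigma>\<^sub>1\<close> not only negates its label but also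
    transports it from \<open>(1, 2)\<close> to the moved pair \<open>(2, 1)\<close>.\<close>
  have inv_sigma: "inv\<^bsub>labelled_perms\<^esub> sigma_image 1
      = (transpose 1 2, \<lambda>a b. if a = 2 \<and> b = 1 then - 1 else 0)"
    by (rule L.inv_equality) (auto simp: sigma_image_def fun_eq_iff transpose_def)
  note not_inner = not_inner_if_label[OF assms h hs hr]
  have b_outer: "?b \<notin> Inn ?G"
    using one inv_sigma by (intro not_inner) (simp_all add: bs br cl hs)
  have c_outer: "?c \<notin> Inn ?G"
    using one by (intro not_inner)
      (simp_all add: cs cr cl hs hr sigma_image_def rho_image_def transpose_def)
  have bc_outer: "?bc \<notin> Inn ?G"
    using one inv_sigma by (intro not_inner)
      (simp_all add: mult b c bs br cs cr cl hs hr rho_image_def transpose_def)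

  have bC: "?b \<in> carrier (AutoGroup ?G)" and cC: "?c \<in> carrier (AutoGroup ?G)"
    using b c by (simp_all add: G.carrier_AutoGroup)
  let ?x = "out_class ?G ?b" and ?y = "out_class ?G ?c"
  have x: "?x \<in> carrier (OutGroup ?G)" and y: "?y \<in> carrier (OutGroup ?G)"
    using bC cC by simp_all
  have "?x \<otimes>\<^bsub>OutGroup ?G\<^esub> ?x = \<one>\<^bsub>OutGroup ?G\<^esub>" "?y \<otimes>\<^bsub>OutGroup ?G\<^esub> ?y = \<one>\<^bsub>OutGroup ?G\<^esub>"
    "?x \<otimes>\<^bsub>OutGroup ?G\<^esub> ?y = ?y \<otimes>\<^bsub>OutGroup ?G\<^esub> ?x"
    using bC cC bb cc bc by (metis C.hom_mult C.hom_one)+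
  moreover have "?x \<noteq> \<one>\<^bsub>OutGroup ?G\<^esub>" "?y \<noteq> \<one>\<^bsub>OutGroup ?G\<^esub>"
    "?x \<otimes>\<^bsub>OutGroup ?G\<^esub> ?y \<noteq> \<one>\<^bsub>OutGroup ?G\<^esub>"
    using b_outer c_outer bc_outer G.out_class_eq_one_iff b c prods(3) C.hom_mult[OF bC cC] by metis+
  ultimately show ?thesis
    using x y by (intro conjI Out.generate_is_subgroup Out.generate_commuting_involutions_iso) auto
qed

end
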